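(* Let $\Pi\subset\mathbb{R}^n$ be a "parallelepiped" bounded by quadrics of the confocal family $$\frac{x_1^2}{a_1-\lambda}+\frac{x_2^2}{a_2-\lambda}+\cdots+\frac{x_n^2}{a_n-\lambda}=1,$$ where $a_1>a_2>\dots>a_n>0$ are fixed and $\lambda$ is the parameter. Then the great diagonals of $\Pi$ are equal.
   Context: Through a generic point of $\mathbb{R}^n$ there pass $n$ pairwise orthogonal quadrics of the confocal family, of $n$ different topological types (one type for $\lambda<a_n$ and one for each interval $a_{i+1}<\lambda<a_i$). A parallelepiped bounded by confocal quadrics is a curvilinear parallelepiped (combinatorially an $n$-cube) whose $2n$ facets lie on confocal quadrics, opposite facets lying on quadrics of the same type and non-opposite facets lying on quadrics of different types (so that adjacent facets are orthogonal). Its great diagonals are the $2^{n-1}$ straight segments in $\mathbb{R}^n$ joining pairs of opposite vertices; "equal" means of equal Euclidean length. *)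

theory Defs
  imports "HOL-Analysis.Analysis"
begin

text \<open>
  The coordinates of \<open>real ^ 'n\<close> are indexed by a finite linear order, whose elements
  in increasing order play the role of the indices \<open>1, \<dots>, n\<close>. The sequence
  \<open>a\<^sub>1 > \<dots> > a\<^sub>n > 0\<close> is then a strictly decreasing positive function \<open>a :: 'n \<Rightarrow> real\<close>.
\<close>

definition confocal_quadric :: "('n::finite \<Rightarrow> real) \<Rightarrow> real \<Rightarrow> (real ^ 'n) set" where
  "confocal_quadric a l = {x. (\<Sum>i\<in>UNIV. (x $ i)\<^sup>2 / (a i - l)) = 1}"

text \<open>
  For decreasing \<open>a\<close>, the condition below says \<open>a\<^bsub>k+1\<^esub> < l < a\<^sub>k\<close> if \<open>k\<close> is not the last
  index, and \<open>l < a\<^sub>n\<close> if it is. Parameters \<open>l = a\<^sub>k\<close> (degenerate members) and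
  \<open>l > a\<^sub>1\<close> (empty quadrics) have no type.
\<close>

definition has_confocal_type :: "('n::{finite,linorder} \<Rightarrow> real) \<Rightarrow> real \<Rightarrow> 'n \<Rightarrow> bool" where
  "has_confocal_type a l k \<longleftrightarrow> l < a k \<and> (\<forall>j. k < j \<longrightarrow> a j < l)"

definition unit_cube :: "(real ^ 'n) set" where
  "unit_cube = {t. \<forall>i. 0 \<le> t $ i \<and> t $ i \<le> 1}"

definition cube_vertices :: "(real ^ 'n) set" where
  "cube_vertices = {v. \<forall>i. v $ i = 0 \<or> v $ i = 1}"

definition cube_facet :: "'n \<Rightarrow> real \<Rightarrow> (real ^ 'n) set" where
  "cube_facet i b = {t \<in> unit_cube. t $ i = b}"

text \<open>
  A curvilinear parallelepiped is a \<open>C\<^sup>1\<close>-diffeomorphic image of the closed unit cube, where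
  regularity holds up to the boundary. A merely topological cube would not do: already in the
  plane it admits quadrilaterals around a focus with a reflex right angle at one vertex, which
  are not parallelepipeds in the intended sense.
\<close>

definition curvilinear_parallelepiped ::
    "(real ^ 'n::finite \<Rightarrow> real ^ 'n) \<Rightarrow> (real ^ 'n) set \<Rightarrow> bool" where
  "curvilinear_parallelepiped \<phi> P \<longleftrightarrow>
     \<phi> ` unit_cube = P \<and> inj_on \<phi> unit_cube \<and>
     (\<exists>J :: real ^ 'n \<Rightarrow> real ^ 'n ^ 'n.
        continuous_on unit_cube J \<and>
        (\<forall>t\<in>unit_cube. (\<phi> has_derivative (\<lambda>h. J t *v h)) (at t within unit_cube) \<and>
                       invertible (J t)))"

text \<open>
  The opposite facets in direction \<open>i\<close> lie on the quadrics with parameters \<open>l i 0\<close> and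
  \<open>l i 1\<close>, both of type \<open>\<tau> i\<close>; injectivity of \<open>\<tau>\<close> says that non-opposite facets lie on
  quadrics of different types.
\<close>

definition confocal_parallelepiped ::
    "('n \<Rightarrow> real) \<Rightarrow> (real ^ 'n::{finite,linorder} \<Rightarrow> real ^ 'n::{finite,linorder})
      \<Rightarrow> (real ^ 'n::{finite,linorder}) set \<Rightarrow> bool" where
  "confocal_parallelepiped a \<phi> P \<longleftrightarrow>
     curvilinear_parallelepiped \<phi> P \<and>
     (\<exists>l \<tau>.
        inj \<tau> \<and>
        (\<forall>i. \<forall>b\<in>{0, 1}. has_confocal_type a (l i b) (\<tau> i) \<and>
                         \<phi> ` cube_facet i b \<subseteq> confocal_quadric a (l i b)))"

text \<open>
  The vertex opposite to \<open>v\<close> in the cube is \<open>1 - v\<close>, where \<open>1\<close> is the all-ones vector.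
\<close>

definition great_diagonal_length :: "(real ^ 'n::finite \<Rightarrow> real ^ 'n) \<Rightarrow> real ^ 'n \<Rightarrow> real" where
  "great_diagonal_length \<phi> v = dist (\<phi> v) (\<phi> (1 - v))"

end

(* At a vertex, which lies on one quadric of each type, the squares of the coordinates are determined
   by the n parameters. Moving along an edge of type k replaces x_i^2 by x_i^2 (a_i - c') / (a_i - c),
   where c, c' are the parameters of type k, and so changes |x|^2 by c - c'. Hence for opposite
   vertices x, y both |x|^2 + |y|^2 and all (x_i y_i)^2 are independent of the diagonal; it remains
   to see that the signs of the x_i y_i are, that is, that parallel edges cross the same coordinate
   hyperplanes the same number of times modulo 2.

   An edge of type k can only cross x_k = 0 and x_{k+1} = 0. If p is the velocity along the edge,
   then p_k x_{k+1} - p_{k+1} x_k never vanishes on it, and at the endpoints its sign is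
   that of x_k x_{k+1} times the normal component of p with respect to the facet at that endpoint.
   As the normal component does not vanish on the facets, the total change of sign of
   x_k x_{k+1} is the same for all parallel edges. Since in a two-dimensional face a coordinate
   that is fixed by one of the two directions changes sign in the same way along both edges of the
   other, this suffices. *)

theory Submission
  imports Defs
begin

section \<open>Cauchy systems of linear equations\<close>

lemma partial_fraction:
  fixes z u w :: real
  assumes "u \<noteq> 0" "w \<noteq> 0" "w \<noteq> u"
  shows "z / u / w = (z / u - z / w) / (w - u)"
proof -
  have "z / u / w * (w - u) = z / u - z / w" using assms by (simp add: field_simps)
  then show ?thesis using assms by (simp add: eq_divide_eq)
qed

text \<open>Injectivity of the Cauchy matrix with entries \<open>1 / (a i - c)\<close>. The
  induction eliminates one unknown \<open>m\<close> at the cost of one equation \<open>c0\<close>;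
  surplus equations are allowed.\<close>

lemma cauchy_system_trivial:
  fixes a :: "'i \<Rightarrow> real"
  assumes "finite A" "finite L" "card A \<le> card L" "inj_on a A"
    and "\<And>i c. i \<in> A \<Longrightarrow> c \<in> L \<Longrightarrow> a i \<noteq> c"
    and "\<And>c. c \<in> L \<Longrightarrow> (\<Sum>i\<in>A. z i / (a i - c)) = 0"
    and "i \<in> A"
  shows "z i = 0"
  using assms
proof (induction A arbitrary: L z i rule: finite_induct)
  case empty
  then show ?case by simp
next
  case (insert m A)
  have "L \<noteq> {}" using insert.prems(2) insert.hyps by auto
  then obtain c0 where c0: "c0 \<in> L" by auto
  define w where "w i = z i / (a i - c0)" for i
  have w0: "sum w (insert m A) = 0"
    using insert.prems(5)[OF c0] by (simp add: w_def)
  \<comment> \<open>The factor \<open>a m - a i\<close> kills the term of \<open>m\<close>, so these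
    are the unknowns of a smaller system; being nonzero on \<open>A\<close>, it can be cancelled
    afterwards.\<close>
  have "w i * (a m - a i) = 0" if "i \<in> A" for i
  proof (rule insert.IH[where L = "L - {c0}"])
    show "card A \<le> card (L - {c0})"
      using insert.prems(1,2) insert.hyps c0 by (simp add: card_Diff_singleton)
    show "(\<Sum>i\<in>A. w i * (a m - a i) / (a i - c)) = 0" if c: "c \<in> L - {c0}" for c
    proof -
      have "w i / (a i - c) = (z i / (a i - c0) - z i / (a i - c)) / (c0 - c)"
        if i: "i \<in> insert m A" for i
      proof -
        have "a i - c \<noteq> 0" "a i - c0 \<noteq> 0" "c0 - c \<noteq> 0"
          using insert.prems(4)[OF i] c c0 by auto
        then show ?thesis
          using partial_fraction[of "a i - c0" "a i - c" "z i"] by (simp add: w_def)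
      qed
      then have "(\<Sum>i\<in>insert m A. w i / (a i - c)) =
          ((\<Sum>i\<in>insert m A. z i / (a i - c0)) - (\<Sum>i\<in>insert m A. z i / (a i - c))) / (c0 - c)"
        by (simp only: sum_divide_distrib flip: sum_subtractf cong: sum.cong)
      then have 1: "(\<Sum>i\<in>insert m A. w i / (a i - c)) = 0"
        using insert.prems(5) c c0 by simp
      \<comment> \<open>Write \<open>a m - a i\<close> as \<open>(a m - c) - (a i - c)\<close>: the
        new equation is then a combination of equation \<open>c\<close> for \<open>w\<close> and of
        \<open>w0\<close>.\<close>
      have "w i * (a m - a i) / (a i - c) = (a m - c) * (w i / (a i - c)) - w i"
        if i: "i \<in> insert m A" for i
      proof -
        have "a i - c \<noteq> 0" using insert.prems(4)[OF i] c by auto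
        then show ?thesis by (simp add: field_simps)
      qed
      then have "(\<Sum>i\<in>insert m A. w i * (a m - a i) / (a i - c)) =
          (a m - c) * (\<Sum>i\<in>insert m A. w i / (a i - c)) - sum w (insert m A)"
        by (simp only: sum_subtractf sum_distrib_left cong: sum.cong)
      also have "\<dots> = 0" using 1 w0 by simp
      finally show ?thesis using insert.hyps by simp
    qed
  qed (use insert.prems insert.hyps that in auto)
  then have wA: "w i = 0" if "i \<in> A" for i
    using that insert.prems(3) insert.hyps by (metis inj_on_insert insert_Diff_single
        mult_eq_0_iff right_minus_eq image_eqI Diff_insert_absorb)
  then have "w m = 0" using w0 insert.hyps by simp
  then have "w i = 0" using wA insert.prems(6) by auto
  then show ?case using insert.prems(4)[OF insert.prems(6) c0] by (simp add: w_def)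
qed

section \<open>Derivatives along segments, and signs on connected sets\<close>

lemma has_derivative_constant_direction:
  fixes f :: "'a::real_normed_vector \<Rightarrow> real"
  assumes der: "(f has_derivative f') (at t within S)"
    and "convex S" "t \<in> S" "t + c *\<^sub>R h \<in> S" "c \<noteq> 0"
    and const: "\<And>s. s \<in> S \<Longrightarrow> f s = k"
  shows "f' h = 0"
proof -
  \<comment> \<open>Restricting \<open>f\<close> to a segment inside \<open>S\<close> reduces the
    claim to uniqueness of a one-sided derivative on \<open>{0..1}\<close>, so \<open>t\<close> may
    lie on the boundary of \<open>S\<close>.\<close>
  define p where "p u = t + u *\<^sub>R (c *\<^sub>R h)" for u :: real
  have pS: "p u \<in> S" if "u \<in> {0..1}" for u
  proof -
    have "p u = (1 - u) *\<^sub>R t + u *\<^sub>R (t + c *\<^sub>R h)"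
      by (simp add: p_def algebra_simps)
    then show ?thesis using assms that by (auto simp: convex_def)
  qed
  have "(p has_derivative (\<lambda>u. u *\<^sub>R (c *\<^sub>R h))) (at 0 within {0..1})"
    unfolding p_def by (auto intro!: derivative_eq_intros)
  moreover have "(f has_derivative f') (at (p 0) within p ` {0..1})"
    using der pS by (auto simp: p_def intro: has_derivative_subset)
  ultimately have "((\<lambda>u. f (p u)) has_derivative (\<lambda>u. f' (u *\<^sub>R (c *\<^sub>R h)))) (at 0 within {0..1})"
    by (rule has_derivative_in_compose)
  moreover have "f' (u *\<^sub>R (c *\<^sub>R h)) = u * (c * f' h)" for u
    using has_derivative_linear[OF der] by (simp add: linear_cmul)
  ultimately have "((\<lambda>u. f (p u)) has_field_derivative c * f' h) (at 0 within {0..1})"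
    by (simp add: has_field_derivative_def mult.commute[of _ "c * f' h"])
  moreover have "((\<lambda>u. f (p u)) has_field_derivative 0) (at 0 within {0..1})"
    by (rule has_field_derivative_transform_within[where f = "\<lambda>_. k" and d = 1])
      (use const pS in auto)
  moreover have "at (0::real) within {0..1} \<noteq> bot"
    by (simp add: at_within_Icc_at_right)
  ultimately have "c * f' h = 0"
    by (blast intro: has_field_derivative_unique)
  then show ?thesis using \<open>c \<noteq> 0\<close> by simp
qed

lemma connected_nonzero_sgn_eq:
  fixes g :: "'a::topological_space \<Rightarrow> real"
  assumes "connected S" "continuous_on S g" "\<And>t. t \<in> S \<Longrightarrow> g t \<noteq> 0" "s \<in> S" "t \<in> S"
  shows "sgn (g s) = sgn (g t)"
proof -
  have iv: "is_interval (g ` S)"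
    using assms(1,2) connected_continuous_image is_interval_connected_1 by blast
  have False if "g u < 0" "0 < g r" "u \<in> S" "r \<in> S" for u r
  proof -
    have "0 \<in> g ` S"
      using mem_is_interval_1_I[OF iv, of "g u" "g r" 0] that by auto
    then show False using assms(3) by auto
  qed
  then show ?thesis using assms(3-5) by (metis linorder_neqE_linordered_idom sgn_neg sgn_pos)
qed

section \<open>Vertices, edges and facets of the cube\<close>

definition flip :: "'n \<Rightarrow> real ^ 'n \<Rightarrow> real ^ 'n" where
  "flip d v = (\<chi> i. if i = d then 1 - v $ i else v $ i)"

lemma flip_nth [simp]: "flip d v $ i = (if i = d then 1 - v $ i else v $ i)"
  by (simp add: flip_def)

lemma flip_flip [simp]: "flip d (flip d v) = v"
  by (simp add: vec_eq_iff)

lemma flip_commute: "flip d (flip e v) = flip e (flip d v)"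
  by (auto simp: vec_eq_iff)

lemma flip_opposite: "flip d (1 - v) = 1 - flip d v"
  by (auto simp: vec_eq_iff)

lemma flip_vertex [simp]: "flip d v \<in> cube_vertices \<longleftrightarrow> v \<in> cube_vertices"
  by (auto simp: cube_vertices_def)

lemma opposite_vertex: "v \<in> cube_vertices \<Longrightarrow> 1 - v \<in> cube_vertices"
  by (auto simp: cube_vertices_def)

text \<open>Two vertices are linked by flipping, one at a time, the coordinates in which they
  differ; the induction is on the number of these.\<close>

lemma flip_invariant_constant:
  fixes v w :: "real ^ 'n::finite"
  assumes inv: "\<And>d u. u \<in> cube_vertices \<Longrightarrow> f (flip d u) = f u"
    and "v \<in> cube_vertices" "w \<in> cube_vertices"
  shows "f v = f w"
  using assms(2,3)
proof (induction "card {i. v $ i \<noteq> w $ i}" arbitrary: v)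
  case 0
  then have "v = w" by (simp add: vec_eq_iff)
  then show ?case by simp
next
  case (Suc n)
  then obtain d where d: "v $ d \<noteq> w $ d"
    by (metis (mono_tags, lifting) card.empty empty_Collect_eq nat.distinct(1))
  have "flip d v $ d = w $ d"
    using d Suc.prems by (auto simp: cube_vertices_def) (metis diff_self diff_zero)+
  then have "{i. flip d v $ i \<noteq> w $ i} = {i. v $ i \<noteq> w $ i} - {d}"
    by auto
  then have "n = card {i. flip d v $ i \<noteq> w $ i}"
    using Suc.hyps(2) d by (simp add: card_Diff_singleton)
  then show ?case
    using Suc.hyps(1)[of "flip d v"] Suc.prems inv[of v d] by simp
qed

definition cube_edge :: "'n \<Rightarrow> real ^ 'n \<Rightarrow> (real ^ 'n) set" where
  "cube_edge d v = {t \<in> unit_cube. \<forall>j. j \<noteq> d \<longrightarrow> t $ j = v $ j}"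

lemma convex_unit_cube: "convex (unit_cube :: (real ^ 'n::finite) set)"
proof -
  have "unit_cube = cbox (0 :: real ^ 'n) 1"
    by (auto simp: unit_cube_def mem_box_cart)
  then show ?thesis using convex_box(1) by metis
qed

lemma convex_coordinate: "convex {t :: real ^ 'n::finite. t $ i = b}"
  by (rule convexI) (auto simp flip: distrib_right)

lemma convex_cube_facet: "convex (cube_facet i b :: (real ^ 'n::finite) set)"
proof -
  have "cube_facet i b = unit_cube \<inter> {t :: real ^ 'n. t $ i = b}"
    by (auto simp: cube_facet_def)
  then show ?thesis by (simp add: convex_Int convex_unit_cube convex_coordinate)
qed

lemma convex_cube_edge: "convex (cube_edge d v :: (real ^ 'n::finite) set)"
proof -
  have "cube_edge d v = unit_cube \<inter> (\<Inter>j\<in>-{d}. {t :: real ^ 'n. t $ j = v $ j})"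
    by (auto simp: cube_edge_def)
  then show ?thesis by (auto intro!: convex_Int convex_INT convex_unit_cube convex_coordinate)
qed

text \<open>Supplies the segment needed to differentiate along an axis at a boundary point. The step
  ends at coordinate 0, or at 1 if \<open>t $ d\<close> is already 0.\<close>

lemma unit_cube_axis_step:
  assumes "t \<in> unit_cube"
  obtains c where "c \<noteq> 0" "t + c *\<^sub>R axis d 1 \<in> unit_cube"
proof (cases "t $ d = 0")
  case True
  then show ?thesis using assms that[of 1] by (auto simp: unit_cube_def axis_def)
next
  case False
  then show ?thesis using assms that[of "- (t $ d)"] by (auto simp: unit_cube_def axis_def)
qed

section \<open>Confocal types and the system of quadrics through a point\<close>

lemma has_confocal_type_sign:
  assumes "has_confocal_type a c k" "\<And>i j. i < j \<Longrightarrow> a j < a i"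
  shows "i \<le> k \<Longrightarrow> c < a i" "k < i \<Longrightarrow> a i < c" "a i \<noteq> c"
  using assms by (metis has_confocal_type_def dual_order.strict_trans order_le_less linorder_not_less less_irrefl)+

lemma has_confocal_type_inj:
  assumes "has_confocal_type a c k" "has_confocal_type a c m"
  shows "k = m"
  using assms by (metis has_confocal_type_def linorder_neqE not_less_iff_gr_or_eq)

text \<open>The situation at a vertex. Directions of the cube index the quadrics, and
  \<open>\<tau>\<close> translates a direction into a type, which is an index of
  coordinates.\<close>

locale orthogonal_quadrics =
  fixes a :: "'n::{finite,linorder} \<Rightarrow> real" and c :: "'n \<Rightarrow> real" and \<tau> :: "'n \<Rightarrow> 'n"
    and x :: "real ^ 'n::{finite,linorder}"
  assumes dec: "\<And>i j. i < j \<Longrightarrow> a j < a i"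
    and inj: "inj \<tau>"
    and type: "\<And>j. has_confocal_type a (c j) (\<tau> j)"
    and quadric: "\<And>j. x \<in> confocal_quadric a (c j)"
begin

lemma inj_a: "inj a"
  by (rule injI) (metis dec linorder_neqE less_irrefl)

lemma inj_c: "inj c"
  by (rule injI) (metis type has_confocal_type_inj inj injD)

lemma neq: "a i - c j \<noteq> 0"
  using has_confocal_type_sign(3)[OF type dec] by simp

lemma quadric_sum: "(\<Sum>i\<in>UNIV. (x $ i)\<^sup>2 / (a i - c j)) = 1"
  using quadric by (simp add: confocal_quadric_def)

text \<open>In the squared coordinates an edge of direction \<open>d\<close> runs along a line, and
  \<open>slope d\<close> is its direction vector: minus the derivative of the squares with respect
  to the parameter.\<close>

definition slope :: "'n \<Rightarrow> 'n \<Rightarrow> real" where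
  "slope d i = (x $ i)\<^sup>2 / (a i - c d)"

text \<open>Orthogonality of the normals of two of the quadrics at \<open>x\<close>, obtained by
  subtracting their equations.\<close>

lemma slope_sum: "j \<noteq> d \<Longrightarrow> (\<Sum>i\<in>UNIV. slope d i / (a i - c j)) = 0"
proof -
  assume "j \<noteq> d"
  then have cc: "c d - c j \<noteq> 0" using inj_c by (auto dest: injD)
  have "slope d i / (a i - c j) =
      ((x $ i)\<^sup>2 / (a i - c d) - (x $ i)\<^sup>2 / (a i - c j)) / (c d - c j)" for i
    using partial_fraction[of "a i - c d" "a i - c j" "(x $ i)\<^sup>2"] neq[of i d] neq[of i j] cc
    by (simp add: slope_def)
  then show ?thesis
    using quadric_sum by (simp add: sum_subtractf flip: sum_divide_distrib)
qed

text \<open>If \<open>x $ m\<close> vanished, the remaining n - 1 slopes would solve n - 1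
  homogeneous Cauchy equations, hence vanish, against the equation of the omitted quadric. Which
  quadric is omitted is immaterial; taking direction \<open>m\<close> lets one set
  \<open>- {m}\<close> index both unknowns and equations.\<close>

lemma coordinate_nonzero: "x $ m \<noteq> 0"
proof
  assume m: "x $ m = 0"
  have "slope m i = 0" if "i \<in> - {m}" for i
  proof (rule cauchy_system_trivial[where L = "c ` (- {m})" and A = "- {m}" and a = a])
    show "card (- {m}) \<le> card (c ` (- {m}))"
      using inj_c by (metis card_image inj_on_subset order_refl subset_UNIV)
    show "(\<Sum>i\<in>- {m}. slope m i / (a i - r)) = 0" if "r \<in> c ` (- {m})" for r
    proof -
      have "(\<Sum>i\<in>- {m}. slope m i / (a i - r)) = (\<Sum>i\<in>UNIV. slope m i / (a i - r))"
        by (rule sum.mono_neutral_left) (auto simp: slope_def m)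
      then show ?thesis using slope_sum that by auto
    qed
  qed (use neq inj_a that in \<open>auto simp: inj_on_def inj_def\<close>)
  then have "slope m i = 0" for i by (cases "i = m") (auto simp: slope_def m)
  then show False using quadric_sum[of m] by (simp flip: slope_def)
qed

lemma slope_pos: "i \<le> \<tau> d \<Longrightarrow> 0 < slope d i"
  using has_confocal_type_sign(1)[OF type dec] coordinate_nonzero
  by (auto simp: slope_def)

lemma slope_neg: "\<tau> d < i \<Longrightarrow> slope d i < 0"
  using has_confocal_type_sign(2)[OF type dec] coordinate_nonzero
  by (auto simp: slope_def divide_pos_neg)

lemma slope_nonzero: "slope d i \<noteq> 0"
  using slope_pos slope_neg by (metis linorder_not_less less_irrefl)

text \<open>As \<open>b\<close> and \<open>c d\<close> have the same type, \<open>slope d i\<close>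
  and \<open>a i - b\<close> change sign at the same index, so every term is positive.\<close>

lemma slope_typed_sum_pos:
  assumes "has_confocal_type a b (\<tau> d)"
  shows "0 < (\<Sum>i\<in>UNIV. slope d i / (a i - b))"
proof (rule sum_pos)
  show "0 < slope d i / (a i - b)" for i
    using slope_pos[of i d] slope_neg[of d i] has_confocal_type_sign[OF assms dec]
    by (cases "i \<le> \<tau> d") (auto simp: divide_neg_neg)
qed auto

text \<open>The n - 1 conditions on the squares of \<open>y\<close> leave one degree of freedom,
  along \<open>slope d\<close> by \<open>slope_sum\<close>. The parameter \<open>s\<close> need not
  have a type: it may equal some \<open>a i\<close>, where a coordinate of \<open>y\<close>
  vanishes.\<close>

lemma edge_squares:
  assumes y: "\<And>j. j \<noteq> d \<Longrightarrow> y \<in> confocal_quadric a (c j)"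
  obtains s where "\<And>i. (y $ i)\<^sup>2 = slope d i * (a i - s)"
proof -
  let ?S = "\<Sum>i\<in>UNIV. slope d i / (a i - c d)"
  have S: "?S \<noteq> 0" using slope_typed_sum_pos[OF type, of d] by simp
  \<comment> \<open>Chosen so that the difference in \<open>0\<close> also satisfies the equation
    with parameter \<open>c d\<close>, which completes a system of n homogeneous equations.\<close>
  define r where "r = ((\<Sum>i\<in>UNIV. (y $ i)\<^sup>2 / (a i - c d)) - 1) / ?S"
  have 0: "(y $ i)\<^sup>2 - (x $ i)\<^sup>2 - r * slope d i = 0" for i
  proof (rule cauchy_system_trivial[where L = "range c" and A = UNIV and a = a])
    show "card (UNIV::'n set) \<le> card (range c)" using inj_c by (simp add: card_image)
    show "(\<Sum>i\<in>UNIV. ((y $ i)\<^sup>2 - (x $ i)\<^sup>2 - r * slope d i) / (a i - b)) = 0"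
      if b: "b \<in> range c" for b
    proof -
      obtain j where j: "b = c j" using b by auto
      have "(\<Sum>i\<in>UNIV. ((y $ i)\<^sup>2 - (x $ i)\<^sup>2 - r * slope d i) / (a i - b)) =
          (\<Sum>i\<in>UNIV. (y $ i)\<^sup>2 / (a i - b)) - (\<Sum>i\<in>UNIV. (x $ i)\<^sup>2 / (a i - b))
          - r * (\<Sum>i\<in>UNIV. slope d i / (a i - b))"
        by (simp add: diff_divide_distrib sum_subtractf sum_distrib_left)
      also have "\<dots> = 0"
      proof (cases "j = d")
        case True
        then show ?thesis using S quadric_sum by (simp add: j r_def)
      next
        case False
        then show ?thesis using y[OF False] slope_sum quadric_sum
          by (simp add: j confocal_quadric_def)
      qed
      finally show ?thesis .
    qed
  qed (use neq inj_a in auto)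
  show ?thesis
  proof (rule that[of "c d - r"])
    show "(y $ i)\<^sup>2 = slope d i * (a i - (c d - r))" for i
      using 0[of i] neq[of i d] by (simp add: slope_def field_simps)
  qed
qed

text \<open>Inserting the form from \<open>edge_squares\<close> into the equation for
  \<open>b\<close> leaves \<open>b - s\<close> times a positive sum, so \<open>s\<close> is
  \<open>b\<close>.\<close>

lemma edge_end_squares:
  assumes y: "\<And>j. j \<noteq> d \<Longrightarrow> y \<in> confocal_quadric a (c j)"
    and yb: "y \<in> confocal_quadric a b" and b: "has_confocal_type a b (\<tau> d)"
  shows "(y $ i)\<^sup>2 = slope d i * (a i - b)"
proof -
  obtain s where s: "\<And>i. (y $ i)\<^sup>2 = slope d i * (a i - s)"
    using edge_squares[OF y] by metis
  have ab: "a i - b \<noteq> 0" for i using has_confocal_type_sign(3)[OF b dec] by simp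
  have "1 = (\<Sum>i\<in>UNIV. (y $ i)\<^sup>2 / (a i - b))"
    using yb by (simp add: confocal_quadric_def)
  also have "\<dots> = (\<Sum>i\<in>UNIV. slope d i + (b - s) * (slope d i / (a i - b)))"
    using s ab by (intro sum.cong) (auto simp: field_simps)
  also have "\<dots> = 1 + (b - s) * (\<Sum>i\<in>UNIV. slope d i / (a i - b))"
    using quadric_sum by (simp add: sum.distrib sum_distrib_left slope_def)
  finally have "b = s" using slope_typed_sum_pos[OF b] by simp
  then show ?thesis using s by simp
qed

text \<open>The entries of \<open>slope d\<close> sum to 1 by the equation of quadric
  \<open>d\<close>, so the squared norm changes by exactly \<open>c d - b\<close>.\<close>

lemma edge_end_norm:
  assumes y: "\<And>j. j \<noteq> d \<Longrightarrow> y \<in> confocal_quadric a (c j)"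
    and yb: "y \<in> confocal_quadric a b" and b: "has_confocal_type a b (\<tau> d)"
  shows "(norm y)\<^sup>2 + b = (norm x)\<^sup>2 + c d"
proof -
  have "(y $ i)\<^sup>2 = (x $ i)\<^sup>2 + (c d - b) * ((x $ i)\<^sup>2 / (a i - c d))" for i
    using edge_end_squares[OF assms] neq[of i d] by (simp add: slope_def field_simps)
  then have "(\<Sum>i\<in>UNIV. (y $ i)\<^sup>2) =
      (\<Sum>i\<in>UNIV. (x $ i)\<^sup>2) + (c d - b) * (\<Sum>i\<in>UNIV. (x $ i)\<^sup>2 / (a i - c d))"
    by (simp only: sum.distrib sum_distrib_left)
  then have "(\<Sum>i\<in>UNIV. (y $ i)\<^sup>2) = (\<Sum>i\<in>UNIV. (x $ i)\<^sup>2) + (c d - b)"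
    by (simp only: quadric_sum mult_1_right)
  moreover have "(norm z)\<^sup>2 = (\<Sum>i\<in>UNIV. (z $ i)\<^sup>2)" for z :: "(real, 'n) vec"
    by (simp add: power2_norm_eq_inner inner_vec_def) (simp add: power2_eq_square)
  ultimately show ?thesis by simp
qed

end

text \<open>Here \<open>\<mu>\<close> is minus half the speed of the parameter \<open>s\<close>. If
  it is nonzero, multiplying the expression by \<open>x m * x k\<close> gives a nonzero number,
  because \<open>C k\<close> and \<open>C m\<close> have opposite signs. If it is zero, the point is
  crossing a coordinate hyperplane and only that coordinate moves.\<close>

lemma edge_wronskian_nonzero:
  fixes C x p a :: "'n::{finite,linorder} \<Rightarrow> real"
  assumes dec: "\<And>i j. i < j \<Longrightarrow> a j < a i"
    and pos: "\<And>i. i \<le> k \<Longrightarrow> 0 < C i" and neg: "\<And>i. k < i \<Longrightarrow> C i < 0"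
    and sq: "\<And>i. (x i)\<^sup>2 = C i * (a i - s)"
    and tangent: "\<And>i. x i * p i = C i * \<mu>"
    and p: "p j \<noteq> 0"
  shows "\<lbrakk>k < m; \<And>j. k < j \<Longrightarrow> m \<le> j\<rbrakk> \<Longrightarrow> p k * x m - p m * x k \<noteq> 0"
    and "(\<And>j. j \<le> k) \<Longrightarrow> p k \<noteq> 0"
proof -
  have C: "C i \<noteq> 0" for i using pos[of i] neg[of i] by fastforce
  have ge: "s \<le> a i" if "i \<le> k" for i
    using zero_le_power2[of "x i"] pos[OF that] by (simp add: sq zero_le_mult_iff)
  have le: "a i \<le> s" if "k < i" for i
    using zero_le_power2[of "x i"] neg[OF that] by (simp add: sq zero_le_mult_iff)
  \<comment> \<open>A moving coordinate \<open>j\<close> must vanish, so \<open>s = a j\<close>.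
    Since \<open>s\<close> lies between the values of \<open>a\<close> at \<open>k\<close> and at
    its successor, \<open>j\<close> is one of these two indices.\<close>
  have single: "p k \<noteq> 0 \<and> x k = 0 \<and> (\<forall>i. i \<noteq> k \<longrightarrow> x i \<noteq> 0 \<and> p i = 0) \<or>
      j \<noteq> k \<and> k < j \<and> (\<forall>i. k < i \<longrightarrow> j \<le> i) \<and> x j = 0 \<and> (\<forall>i. i \<noteq> j \<longrightarrow> x i \<noteq> 0 \<and> p i = 0)"
    if "\<mu> = 0"
  proof -
    have xj: "x j = 0" using tangent[of j] p that by simp
    then have s: "s = a j" using sq[of j] C[of j] by simp
    have oth: "x i \<noteq> 0 \<and> p i = 0" if "i \<noteq> j" for i
    proof -
      have "a i \<noteq> a j" using dec that by (metis linorder_neqE less_irrefl)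
      then have "x i \<noteq> 0" using sq[of i] C[of i] s by auto
      then show ?thesis using tangent[of i] \<open>\<mu> = 0\<close> by simp
    qed
    show ?thesis
    proof (cases "j \<le> k")
      case True
      then have "j = k" using ge[of k] dec[of j k] s by fastforce
      then show ?thesis using p xj oth by auto
    next
      case False
      have "\<forall>i. k < i \<longrightarrow> j \<le> i"
      proof (intro allI impI)
        fix i assume "k < i"
        then have "a i \<le> a j" using le s by simp
        then show "j \<le> i" by (metis dec not_less)
      qed
      then show ?thesis using False xj oth by auto
    qed
  qed
  have nz: "x i \<noteq> 0 \<and> p i \<noteq> 0" if "\<mu> \<noteq> 0" for i
    using tangent[of i] C[of i] that by auto
  show "p k * x m - p m * x k \<noteq> 0" if m: "k < m" "\<And>j. k < j \<Longrightarrow> m \<le> j"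
  proof (cases "\<mu> = 0")
    case True
    from single[OF this] show ?thesis
    proof (elim disjE conjE)
      assume "p k \<noteq> 0" "\<forall>i. i \<noteq> k \<longrightarrow> x i \<noteq> 0 \<and> p i = 0"
      then show ?thesis using m(1) by simp
    next
      assume j: "j \<noteq> k" "k < j" "\<forall>i. k < i \<longrightarrow> j \<le> i"
        and oth: "\<forall>i. i \<noteq> j \<longrightarrow> x i \<noteq> 0 \<and> p i = 0"
      have "j = m" using j m by (simp add: antisym)
      then show ?thesis using oth j p by simp
    qed
  next
    case False
    have "(p k * x m - p m * x k) * (x m * x k) =
        (x k * p k) * (x m)\<^sup>2 - (x m * p m) * (x k)\<^sup>2"
      by (simp add: algebra_simps power2_eq_square)
    also have "\<dots> = \<mu> * (C k * (x m)\<^sup>2 - C m * (x k)\<^sup>2)"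
      by (simp only: tangent) (simp add: algebra_simps)
    finally have "(p k * x m - p m * x k) * (x m * x k) = \<dots>" .
    moreover have "0 < C k * (x m)\<^sup>2" using pos nz[OF False, of m] by simp
    moreover have "C m * (x k)\<^sup>2 < 0" using neg[OF m(1)] nz[OF False, of k] by (simp add: mult_neg_pos)
    ultimately show ?thesis using False by auto
  qed
  show "p k \<noteq> 0" if "\<And>j. j \<le> k"
    using single nz[of k] that[of j] by (auto simp: not_less[symmetric])
qed

section \<open>Velocities along edges and normal speeds on facets\<close>

locale confocal_cube =
  fixes a :: "'n::{finite,linorder} \<Rightarrow> real"
    and \<phi> :: "real ^ 'n::{finite,linorder} \<Rightarrow> real ^ 'n::{finite,linorder}"
    and J :: "real ^ 'n::{finite,linorder} \<Rightarrow> real ^ 'n::{finite,linorder} ^ 'n::{finite,linorder}"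
    and l :: "'n \<Rightarrow> real \<Rightarrow> real" and \<tau> :: "'n \<Rightarrow> 'n"
  assumes dec: "\<And>i j. i < j \<Longrightarrow> a j < a i"
    and inj: "inj \<tau>"
    and type: "\<And>i b. b \<in> {0, 1} \<Longrightarrow> has_confocal_type a (l i b) (\<tau> i)"
    and facet: "\<And>i b t. b \<in> {0, 1} \<Longrightarrow> t \<in> cube_facet i b \<Longrightarrow> \<phi> t \<in> confocal_quadric a (l i b)"
    and continuous_J: "continuous_on unit_cube J"
    and derivative: "\<And>t. t \<in> unit_cube \<Longrightarrow> (\<phi> has_derivative (\<lambda>h. J t *v h)) (at t within unit_cube)"
    and invertible_J: "\<And>t. t \<in> unit_cube \<Longrightarrow> invertible (J t)"
begin

abbreviation velocity :: "'n \<Rightarrow> (real, 'n) vec \<Rightarrow> 'n \<Rightarrow> real" where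
  "velocity d t i \<equiv> (J t *v axis d 1) $ i"

abbreviation vertex_slope :: "(real, 'n) vec \<Rightarrow> 'n \<Rightarrow> 'n \<Rightarrow> real" where
  "vertex_slope v \<equiv> orthogonal_quadrics.slope a (\<lambda>j. l j (v $ j)) (\<phi> v)"

lemma vertex_bit: "v \<in> cube_vertices \<Longrightarrow> v $ j \<in> {0, 1}"
  by (auto simp: cube_vertices_def)

lemma vertex_in_facet: "v \<in> cube_vertices \<Longrightarrow> v \<in> cube_facet j (v $ j)"
  by (auto simp: cube_vertices_def cube_facet_def unit_cube_def)
    (metis order_refl zero_le_one)+

lemma vertex_quadrics:
  assumes "v \<in> cube_vertices"
  shows "orthogonal_quadrics a (\<lambda>j. l j (v $ j)) \<tau> (\<phi> v)"
  by unfold_locales (use dec inj type facet vertex_bit vertex_in_facet assms in blast)+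

lemma edge_in_cube: "t \<in> cube_edge d v \<Longrightarrow> t \<in> unit_cube"
  by (simp add: cube_edge_def)

lemma edge_quadric:
  assumes "v \<in> cube_vertices" "t \<in> cube_edge d v" "j \<noteq> d"
  shows "\<phi> t \<in> confocal_quadric a (l j (v $ j))"
  using assms by (intro facet[OF vertex_bit]) (auto simp: cube_edge_def cube_facet_def)

lemma vertex_in_edge:
  assumes "v \<in> cube_vertices"
  shows "v \<in> cube_edge d v" "flip d v \<in> cube_edge d v"
  using assms vertex_in_facet[of v] vertex_in_facet[of "flip d v"]
  by (auto simp: cube_edge_def cube_facet_def)

lemma velocity_nonzero: "t \<in> unit_cube \<Longrightarrow> \<exists>i. velocity d t i \<noteq> 0"
proof (rule ccontr)
  assume t: "t \<in> unit_cube" and "\<not> (\<exists>i. velocity d t i \<noteq> 0)"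
  then have "J t *v axis d 1 = 0" by (simp add: vec_eq_iff)
  then have "axis d (1::real) = (0 :: (real, 'n) vec)"
    using invertible_J[OF t] by (metis invertible_left_inverse matrix_left_invertible_ker)
  then show False by (simp add: axis_eq_0_iff)
qed

lemma continuous_phi: "continuous_on unit_cube \<phi>"
  using derivative by (meson has_derivative_continuous continuous_on_eq_continuous_within)

lemma continuous_velocity: "continuous_on unit_cube (\<lambda>t. velocity d t i)"
  by (simp add: matrix_vector_mult_def axis_def if_distrib sum.delta cong: if_cong)
    (intro continuous_intros continuous_J)

lemma derivative_square:
  assumes "t \<in> unit_cube"
  shows "((\<lambda>t. (\<phi> t $ i)\<^sup>2) has_derivative (\<lambda>h. 2 * (\<phi> t $ i * (J t *v h) $ i))) (at t within unit_cube)"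
proof -
  have "((\<lambda>t. \<phi> t $ i) has_derivative (\<lambda>h. (J t *v h) $ i)) (at t within unit_cube)"
    using bounded_linear.has_derivative[OF bounded_linear_vec_nth derivative[OF assms]] .
  from has_derivative_power[OF this, of 2] show ?thesis
    by (simp add: mult_ac)
qed

lemma cube_edge_squares:
  assumes v: "v \<in> cube_vertices" and t: "t \<in> cube_edge d v"
  obtains s where "\<And>i. (\<phi> t $ i)\<^sup>2 = vertex_slope v d i * (a i - s)"
proof -
  interpret orthogonal_quadrics a "\<lambda>j. l j (v $ j)" \<tau> "\<phi> v"
    by (rule vertex_quadrics[OF v])
  show ?thesis
    by (rule edge_squares[of d "\<phi> t"]) (use edge_quadric[OF v t] that in auto)
qed

text \<open>By \<open>cube_edge_squares\<close>, each square divided by its slope is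
  \<open>a i - s\<close> with a common \<open>s\<close>. Differences of two such quotients are
  constant on the edge; differentiating these avoids any question whether \<open>s\<close> is
  differentiable in \<open>t\<close>. Coordinate \<open>d\<close> is only a reference.\<close>

lemma edge_tangent:
  assumes v: "v \<in> cube_vertices" and t: "t \<in> cube_edge d v"
  obtains \<mu> where "\<And>i. \<phi> t $ i * velocity d t i = vertex_slope v d i * \<mu>"
proof -
  interpret orthogonal_quadrics a "\<lambda>j. l j (v $ j)" \<tau> "\<phi> v"
    by (rule vertex_quadrics[OF v])
  have tc: "t \<in> unit_cube" using t by (rule edge_in_cube)
  obtain r where r: "r \<noteq> 0" "t + r *\<^sub>R axis d 1 \<in> unit_cube"
    using unit_cube_axis_step[OF tc] by metis
  have r': "t + r *\<^sub>R axis d 1 \<in> cube_edge d v"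
    using r t by (auto simp: cube_edge_def axis_def)
  let ?C = "slope d"
  have "2 * (\<phi> t $ i * velocity d t i) / ?C i - 2 * (\<phi> t $ d * velocity d t d) / ?C d = 0" for i
  proof (rule has_derivative_constant_direction[OF _ convex_cube_edge t r' r(1)])
    show "((\<lambda>t. (\<phi> t $ i)\<^sup>2 / ?C i - (\<phi> t $ d)\<^sup>2 / ?C d) has_derivative
        (\<lambda>h. 2 * (\<phi> t $ i * (J t *v h) $ i) / ?C i - 2 * (\<phi> t $ d * (J t *v h) $ d) / ?C d))
        (at t within cube_edge d v)"
      by (intro has_derivative_diff bounded_linear.has_derivative[OF bounded_linear_divide]
          has_derivative_subset[OF derivative_square[OF tc]]) (auto dest: edge_in_cube)
    show "(\<phi> u $ i)\<^sup>2 / ?C i - (\<phi> u $ d)\<^sup>2 / ?C d = a i - a d" if u: "u \<in> cube_edge d v" for u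
    proof -
      obtain s where "\<And>i. (\<phi> u $ i)\<^sup>2 = slope d i * (a i - s)"
        using cube_edge_squares[OF v u] by metis
      then show ?thesis using slope_nonzero[of d] by simp
    qed
  qed
  then show ?thesis
    using that[of "\<phi> t $ d * velocity d t d / ?C d"] slope_nonzero[of d]
    by (simp add: field_simps)
qed

text \<open>Inner product of the velocity with half the gradient of the function defining the
  quadric of parameter \<open>l d b\<close>.\<close>

definition normal_speed :: "'n \<Rightarrow> real \<Rightarrow> (real, 'n) vec \<Rightarrow> real" where
  "normal_speed d b t = (\<Sum>i\<in>UNIV. \<phi> t $ i * velocity d t i / (a i - l d b))"

text \<open>The images of all other axes are tangent to the facet, hence orthogonal to the normal
  \<open>n\<close>. If the image of axis \<open>d\<close> were too, invertibility of
  \<open>J t\<close> would force \<open>n = 0\<close>, which no point of the quadric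
  permits.\<close>

lemma normal_speed_nonzero:
  assumes b: "b \<in> {0, 1}" and t: "t \<in> cube_facet d b"
  shows "normal_speed d b t \<noteq> 0"
proof
  assume 0: "normal_speed d b t = 0"
  have tc: "t \<in> unit_cube" using t by (simp add: cube_facet_def)
  define n :: "(real, 'n) vec" where "n = (\<chi> i. \<phi> t $ i / (a i - l d b))"
  have "(J t *v axis e 1) \<bullet> n = 0" for e
  proof (cases "e = d")
    case True
    then show ?thesis using 0 by (simp add: normal_speed_def inner_vec_def n_def mult.commute)
  next
    case False
    obtain r where r: "r \<noteq> 0" "t + r *\<^sub>R axis e 1 \<in> unit_cube"
      using unit_cube_axis_step[OF tc] by metis
    have r': "t + r *\<^sub>R axis e 1 \<in> cube_facet d b"
      using r t False by (auto simp: cube_facet_def axis_def)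
    have "(\<Sum>i\<in>UNIV. 2 * (\<phi> t $ i * velocity e t i) / (a i - l d b)) = 0"
    proof (rule has_derivative_constant_direction[OF _ convex_cube_facet t r' r(1)])
      show "((\<lambda>t. \<Sum>i\<in>UNIV. (\<phi> t $ i)\<^sup>2 / (a i - l d b)) has_derivative
          (\<lambda>h. \<Sum>i\<in>UNIV. 2 * (\<phi> t $ i * (J t *v h) $ i) / (a i - l d b)))
          (at t within cube_facet d b)"
        by (intro has_derivative_sum bounded_linear.has_derivative[OF bounded_linear_divide]
            has_derivative_subset[OF derivative_square[OF tc]]) (auto simp: cube_facet_def)
      show "(\<Sum>i\<in>UNIV. (\<phi> u $ i)\<^sup>2 / (a i - l d b)) = 1" if "u \<in> cube_facet d b" for u
        using facet[OF b that] by (simp add: confocal_quadric_def)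
    qed
    then have "2 * ((J t *v axis e 1) \<bullet> n) = 0"
      by (simp add: inner_vec_def n_def sum_distrib_left mult_ac)
    then show ?thesis by simp
  qed
  moreover have "(transpose (J t) *v n) $ e = (J t *v axis e 1) \<bullet> n" for e
    unfolding matrix_vector_mult_basis
    by (simp add: column_def inner_vec_def matrix_vector_mult_def transpose_def
        del: transpose_matrix_vector)
  ultimately have "transpose (J t) *v n = 0" by (simp add: vec_eq_iff)
  moreover have "invertible (transpose (J t))"
    using invertible_J[OF tc] by (simp add: transpose_invertible)
  ultimately have "n = 0"
    by (metis invertible_left_inverse matrix_left_invertible_ker)
  then have "\<phi> t $ i / (a i - l d b) = 0" for i by (simp add: n_def vec_eq_iff)
  then have "(\<phi> t $ i)\<^sup>2 / (a i - l d b) = 0" for i by (simp add: power2_eq_square)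
  then have "(\<Sum>i\<in>UNIV. (\<phi> t $ i)\<^sup>2 / (a i - l d b)) = 0" by (simp only: sum.neutral_const)
  then show False using facet[OF b t] by (simp add: confocal_quadric_def)
qed

lemma normal_speed_sgn:
  assumes "b \<in> {0, 1}" "s \<in> cube_facet d b" "t \<in> cube_facet d b"
  shows "sgn (normal_speed d b s) = sgn (normal_speed d b t)"
proof (rule connected_nonzero_sgn_eq[OF convex_connected[OF convex_cube_facet] _ _ assms(2,3)])
  have sub: "cube_facet d b \<subseteq> unit_cube" by (auto simp: cube_facet_def)
  have "a i - l d b \<noteq> 0" for i
    using has_confocal_type_sign(3)[OF type[OF assms(1)] dec] by simp
  then show "continuous_on (cube_facet d b) (normal_speed d b)"
    unfolding normal_speed_def
    by (intro continuous_on_sum continuous_on_divide continuous_on_mult continuous_on_const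
        continuous_on_component continuous_on_subset[OF continuous_phi sub]
        continuous_on_subset[OF continuous_velocity sub]) auto
qed (use normal_speed_nonzero assms in auto)

text \<open>At a vertex the normal speed is \<open>\<mu>\<close> times a positive sum, so it has the
  sign of \<open>\<mu>\<close>; the left-hand sides are then read off from
  \<open>edge_tangent\<close> and the signs of the slopes.\<close>

lemma vertex_normal_speed:
  assumes v: "v \<in> cube_vertices"
  shows "sgn (velocity d v (\<tau> d) * \<phi> v $ \<tau> d) = sgn (normal_speed d (v $ d) v)"
    and "\<tau> d < m \<Longrightarrow> sgn (velocity d v (\<tau> d) * \<phi> v $ m - velocity d v m * \<phi> v $ \<tau> d)
      = sgn (normal_speed d (v $ d) v) * sgn (\<phi> v $ \<tau> d * \<phi> v $ m)"
proof -
  interpret orthogonal_quadrics a "\<lambda>j. l j (v $ j)" \<tau> "\<phi> v"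
    by (rule vertex_quadrics[OF v])
  let ?x = "\<lambda>i. \<phi> v $ i" and ?p = "velocity d v" and ?k = "\<tau> d"
  obtain \<mu> where mu: "\<And>i. ?x i * ?p i = slope d i * \<mu>"
    using edge_tangent[OF v vertex_in_edge(1)[OF v]] by metis
  have "normal_speed d (v $ d) v = \<mu> * (\<Sum>i\<in>UNIV. slope d i / (a i - l d (v $ d)))"
    by (simp add: normal_speed_def mu sum_distrib_left mult.commute)
  then have N: "sgn (normal_speed d (v $ d) v) = sgn \<mu>"
    using slope_typed_sum_pos[OF type[of d]] by (simp add: sgn_mult)
  show "sgn (?p ?k * ?x ?k) = sgn (normal_speed d (v $ d) v)"
    using mu[of ?k] slope_pos[of ?k d] by (simp add: N sgn_mult mult.commute)
  show "sgn (?p ?k * ?x m - ?p m * ?x ?k) = sgn (normal_speed d (v $ d) v) * sgn (?x ?k * ?x m)"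
    if m: "?k < m"
  proof -
    have "(?p ?k * ?x m - ?p m * ?x ?k) * (?x ?k * ?x m) =
        (?x ?k * ?p ?k) * (?x m)\<^sup>2 - (?x m * ?p m) * (?x ?k)\<^sup>2"
      by (simp add: algebra_simps power2_eq_square)
    also have "\<dots> = \<mu> * (slope d ?k * (?x m)\<^sup>2 - slope d m * (?x ?k)\<^sup>2)"
      by (simp only: mu) (simp add: algebra_simps)
    finally have eq: "(?p ?k * ?x m - ?p m * ?x ?k) * (?x ?k * ?x m) = \<dots>" .
    have "0 < slope d ?k * (?x m)\<^sup>2" "slope d m * (?x ?k)\<^sup>2 < 0"
      using slope_pos[of ?k d] slope_neg[OF m] coordinate_nonzero
      by (simp_all add: mult_neg_pos)
    then have "sgn (slope d ?k * (?x m)\<^sup>2 - slope d m * (?x ?k)\<^sup>2) = 1" by simp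
    then have "sgn (?p ?k * ?x m - ?p m * ?x ?k) * sgn (?x ?k * ?x m) = sgn \<mu>"
      using arg_cong[OF eq, of sgn] by (simp add: sgn_mult)
    moreover have "sgn (?x ?k * ?x m) * sgn (?x ?k * ?x m) = 1"
      using coordinate_nonzero by (simp add: sgn_mult sgn_if)
    ultimately show ?thesis by (metis N mult.assoc mult.right_neutral)
  qed
qed

lemma flip_edge_sgn_eq:
  assumes v: "v \<in> cube_vertices"
    and "continuous_on unit_cube g" "\<And>t. t \<in> cube_edge d v \<Longrightarrow> g t \<noteq> (0::real)"
  shows "sgn (g v) = sgn (g (flip d v))"
proof (rule connected_nonzero_sgn_eq[OF convex_connected[OF convex_cube_edge]])
  show "continuous_on (cube_edge d v) g"
    using assms(2) by (rule continuous_on_subset) (auto dest: edge_in_cube)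
qed (use assms vertex_in_edge in auto)

section \<open>Sign changes of coordinates along edges\<close>

definition covers :: "'n \<Rightarrow> 'n \<Rightarrow> bool" where
  "covers k m \<longleftrightarrow> k < m \<and> (\<forall>j. k < j \<longrightarrow> m \<le> j)"

lemma covers_exists: "k < j \<Longrightarrow> \<exists>m. covers k m"
proof
  assume "k < j"
  then have "Min {i. k < i} \<in> {i. k < i}" by (intro Min_in) auto
  then show "covers k (Min {i. k < i})" by (auto simp: covers_def)
qed

text \<open>On the edge \<open>s\<close> stays between the values of \<open>a\<close> at
  \<open>\<tau> d\<close> and at its successor, so it never meets \<open>a i\<close> for any other
  \<open>i\<close>, and that coordinate does not vanish.\<close>

lemma flip_sgn_fixed:
  assumes v: "v \<in> cube_vertices" and i: "i \<noteq> \<tau> d" "\<not> covers (\<tau> d) i"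
  shows "sgn (\<phi> v $ i) = sgn (\<phi> (flip d v) $ i)"
proof (rule flip_edge_sgn_eq[OF v])
  interpret orthogonal_quadrics a "\<lambda>j. l j (v $ j)" \<tau> "\<phi> v"
    by (rule vertex_quadrics[OF v])
  show "continuous_on unit_cube (\<lambda>t. \<phi> t $ i)"
    by (intro continuous_on_component continuous_phi)
  fix t assume t: "t \<in> cube_edge d v"
  obtain s where s: "\<And>i. (\<phi> t $ i)\<^sup>2 = slope d i * (a i - s)"
    using cube_edge_squares[OF v t] by metis
  have ge: "s \<le> a j" if "j \<le> \<tau> d" for j
    using zero_le_power2[of "\<phi> t $ j"] slope_pos[OF that] by (simp add: s zero_le_mult_iff)
  have le: "a j \<le> s" if "\<tau> d < j" for j
    using zero_le_power2[of "\<phi> t $ j"] slope_neg[OF that] by (simp add: s zero_le_mult_iff)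
  have "a i \<noteq> s"
  proof (cases "i < \<tau> d")
    case True
    then show ?thesis using dec[OF True] ge[of "\<tau> d"] by simp
  next
    case False
    then have "\<tau> d < i" using i by simp
    then obtain j where j: "\<tau> d < j" "j < i" using i by (auto simp: covers_def)
    then show ?thesis using dec[OF j(2)] le[OF j(1)] by simp
  qed
  then show "\<phi> t $ i \<noteq> 0" using s[of i] slope_nonzero[of d i] by auto
qed

lemma vertex_sgn_square: "v \<in> cube_vertices \<Longrightarrow> sgn (\<phi> v $ i) * sgn (\<phi> v $ i) = 1"
  using orthogonal_quadrics.coordinate_nonzero[OF vertex_quadrics] by (simp add: sgn_if)

definition sign_change :: "'n \<Rightarrow> 'n \<Rightarrow> (real, 'n) vec \<Rightarrow> real" where
  "sign_change d i v = sgn (\<phi> v $ i) * sgn (\<phi> (flip d v) $ i)"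

text \<open>Compares the senses in which edges of direction \<open>d\<close> meet their two end
  quadrics. The vectors 0 and 1 merely represent the two facets, on each of which the sign is
  constant.\<close>

definition orientation_change :: "'n \<Rightarrow> real" where
  "orientation_change d = sgn (normal_speed d 0 0) * sgn (normal_speed d 1 1)"

lemma orientation_change_vertex:
  assumes v: "v \<in> cube_vertices"
  shows "sgn (normal_speed d (v $ d) v) * sgn (normal_speed d (flip d v $ d) (flip d v))
    = orientation_change d"
proof -
  have N: "sgn (normal_speed d (u $ d) u) = sgn (normal_speed d (u $ d) (\<chi> i. u $ d))"
    if u: "u \<in> cube_vertices" for u
    using vertex_bit[OF u, of d]
    by (intro normal_speed_sgn vertex_bit vertex_in_facet u) (auto simp: cube_facet_def unit_cube_def)
  have "(\<chi> i. 0) = (0 :: (real, 'n) vec)" "(\<chi> i. 1) = (1 :: (real, 'n) vec)"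
    by (simp_all add: vec_eq_iff)
  then show ?thesis
    using N[OF v] N[of "flip d v"] v vertex_bit[OF v, of d]
    by (auto simp: orientation_change_def mult.commute)
qed

lemma edge_tangent_data:
  assumes v: "v \<in> cube_vertices" and t: "t \<in> cube_edge d v"
  shows "covers (\<tau> d) m \<Longrightarrow>
      velocity d t (\<tau> d) * \<phi> t $ m - velocity d t m * \<phi> t $ \<tau> d \<noteq> 0"
    and "(\<And>j. j \<le> \<tau> d) \<Longrightarrow> velocity d t (\<tau> d) \<noteq> 0"
proof -
  interpret orthogonal_quadrics a "\<lambda>j. l j (v $ j)" \<tau> "\<phi> v"
    by (rule vertex_quadrics[OF v])
  obtain s where s: "\<And>i. (\<phi> t $ i)\<^sup>2 = slope d i * (a i - s)"
    using cube_edge_squares[OF v t] by metis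
  obtain \<mu> where mu: "\<And>i. \<phi> t $ i * velocity d t i = slope d i * \<mu>"
    using edge_tangent[OF v t] by metis
  obtain j where j: "velocity d t j \<noteq> 0"
    using velocity_nonzero[OF edge_in_cube[OF t]] by metis
  note wronskian = edge_wronskian_nonzero[where a = a and C = "slope d" and k = "\<tau> d"
      and x = "\<lambda>i. \<phi> t $ i" and p = "velocity d t", OF dec slope_pos slope_neg s mu j]
  show "velocity d t (\<tau> d) * \<phi> t $ m - velocity d t m * \<phi> t $ \<tau> d \<noteq> 0" if "covers (\<tau> d) m"
    by (rule wronskian(1)) (use that in \<open>auto simp: covers_def\<close>)
  show "velocity d t (\<tau> d) \<noteq> 0" if "\<And>j. j \<le> \<tau> d"
    by (rule wronskian(2)) (use that in auto)
qed

text \<open>The expression in \<open>edge_tangent_data\<close> keeps its sign along the edge, and at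
  either end this sign is that of the normal speed times that of the product of the two coordinates.
  The right-hand side does not involve \<open>v\<close>.\<close>

lemma sign_change_pair:
  assumes v: "v \<in> cube_vertices" and m: "covers (\<tau> d) m"
  shows "sign_change d (\<tau> d) v * sign_change d m v = orientation_change d"
proof -
  have km: "\<tau> d < m" using m by (simp add: covers_def)
  let ?v = "flip d v"
  have v': "?v \<in> cube_vertices" using v by simp
  have "sgn (velocity d v (\<tau> d) * \<phi> v $ m - velocity d v m * \<phi> v $ \<tau> d) =
      sgn (velocity d ?v (\<tau> d) * \<phi> ?v $ m - velocity d ?v m * \<phi> ?v $ \<tau> d)"
  proof (rule flip_edge_sgn_eq[OF v])
    show "continuous_on unit_cube (\<lambda>t. velocity d t (\<tau> d) * \<phi> t $ m - velocity d t m * \<phi> t $ \<tau> d)"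
      by (intro continuous_on_diff continuous_on_mult continuous_velocity
          continuous_on_component[OF continuous_phi])
  qed (rule edge_tangent_data(1)[OF v _ m])
  then have eq: "sgn (normal_speed d (v $ d) v) * (sgn (\<phi> v $ \<tau> d) * sgn (\<phi> v $ m)) =
      sgn (normal_speed d (?v $ d) ?v) * (sgn (\<phi> ?v $ \<tau> d) * sgn (\<phi> ?v $ m))"
    by (simp only: vertex_normal_speed(2)[OF v km] vertex_normal_speed(2)[OF v' km] sgn_mult)
  have n: "sgn (normal_speed d (v $ d) v) * sgn (normal_speed d (v $ d) v) = 1"
    using normal_speed_nonzero[OF vertex_bit[OF v] vertex_in_facet[OF v]] by (simp add: sgn_if)
  note q = vertex_sgn_square[OF v'] n
  show ?thesis
    unfolding orientation_change_vertex[OF v, symmetric] sign_change_def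
    using eq q(1)[of "\<tau> d"] q(1)[of m] q(2) by algebra
qed

text \<open>The last index has no successor, so a single coordinate can be crossed, and its velocity
  alone never vanishes.\<close>

lemma sign_change_last:
  assumes v: "v \<in> cube_vertices" and max: "\<And>j. j \<le> \<tau> d"
  shows "sign_change d (\<tau> d) v = orientation_change d"
proof -
  let ?v = "flip d v"
  have v': "?v \<in> cube_vertices" using v by simp
  have eq: "sgn (velocity d v (\<tau> d)) = sgn (velocity d ?v (\<tau> d))"
    by (rule flip_edge_sgn_eq[OF v continuous_velocity edge_tangent_data(2)[OF v _ max]])
  have "velocity d v (\<tau> d) \<noteq> 0"
    by (rule edge_tangent_data(2)[OF v vertex_in_edge(1)[OF v] max])
  then have "sgn (velocity d v (\<tau> d)) * sgn (velocity d v (\<tau> d)) = 1"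
    by (simp add: sgn_if)
  then show ?thesis
    unfolding orientation_change_vertex[OF v, symmetric] sign_change_def
    unfolding vertex_normal_speed(1)[OF v, symmetric] vertex_normal_speed(1)[OF v', symmetric] sgn_mult
    using eq by algebra
qed

lemma sign_change_fixed:
  assumes "v \<in> cube_vertices" "i \<noteq> \<tau> d" "\<not> covers (\<tau> d) i"
  shows "sign_change d i v = 1"
  using flip_sgn_fixed[OF assms] vertex_sgn_square[of v i] assms(1) by (simp add: sign_change_def)

text \<open>In the two-dimensional face spanned by \<open>d\<close> and \<open>e\<close>, both edges
  of direction \<open>e\<close> preserve the sign of coordinate \<open>i\<close>, so the two edges
  of direction \<open>d\<close> have the same signs at corresponding ends.\<close>

lemma sign_change_flip_fixed:
  assumes v: "v \<in> cube_vertices" and i: "i \<noteq> \<tau> e" "\<not> covers (\<tau> e) i"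
  shows "sign_change d i (flip e v) = sign_change d i v"
  using flip_sgn_fixed[OF v i] flip_sgn_fixed[of "flip d v", OF _ i] v
  by (simp add: sign_change_def flip_commute[of d e])

lemma sign_change_nonzero:
  assumes v: "v \<in> cube_vertices"
  shows "sign_change d i v \<noteq> 0"
proof
  assume "sign_change d i v = 0"
  then have "sgn (\<phi> v $ i) = 0 \<or> sgn (\<phi> (flip d v) $ i) = 0"
    by (simp only: sign_change_def mult_eq_0_iff)
  moreover have v': "flip d v \<in> cube_vertices" using v by simp
  ultimately show False
    using vertex_sgn_square[OF v, of i] vertex_sgn_square[OF v', of i]
    by (metis mult_zero_left zero_neq_one)
qed

text \<open>A coordinate affected by flips in two different directions \<open>d\<close>, \<open>e\<close> is treated by passing,
  via the product formula, to the other coordinate affected by \<open>d\<close>, which \<open>e\<close> leaves alone.\<close>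

lemma sign_change_flip:
  assumes v: "v \<in> cube_vertices"
  shows "sign_change d i (flip e v) = sign_change d i v"
proof -
  have v': "flip e v \<in> cube_vertices" using v by simp
  consider "e = d" | "i \<noteq> \<tau> e" "\<not> covers (\<tau> e) i" | "i \<noteq> \<tau> d" "\<not> covers (\<tau> d) i"
    | "e \<noteq> d" "i = \<tau> d" "covers (\<tau> e) i"
    | "e \<noteq> d" "covers (\<tau> d) i" "i = \<tau> e"
    | "e \<noteq> d" "covers (\<tau> d) i" "covers (\<tau> e) i"
    | "e \<noteq> d" "i = \<tau> d" "i = \<tau> e"
    by blast
  then show ?thesis
  proof cases
    case 1
    then show ?thesis by (simp add: sign_change_def)
  next
    case 2
    then show ?thesis by (rule sign_change_flip_fixed[OF v])
  next
    case 3
    then show ?thesis using v v' by (simp add: sign_change_fixed)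
  next
    case 4
    show ?thesis
    proof (cases "\<exists>m. covers (\<tau> d) m")
      case True
      then obtain m where m: "covers (\<tau> d) m" by blast
      then have "m \<noteq> \<tau> e" "\<not> covers (\<tau> e) m"
        using 4 by (fastforce simp: covers_def)+
      then have "sign_change d m (flip e v) = sign_change d m v"
        by (rule sign_change_flip_fixed[OF v])
      moreover have "sign_change d i (flip e v) * sign_change d m (flip e v)
          = sign_change d i v * sign_change d m v"
        using sign_change_pair[OF v m] sign_change_pair[OF v' m] 4 by simp
      ultimately show ?thesis using sign_change_nonzero[OF v, of d m] by simp
    next
      \<comment> \<open>Without a second affected coordinate \<open>\<tau> d\<close> is the last
        index, and \<open>sign_change_last\<close> gives the value outright.\<close>
      case False
      then have "j \<le> \<tau> d" for j using covers_exists by (metis not_less)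
      then show ?thesis using sign_change_last v v' 4 by simp
    qed
  next
    case 5
    then have "\<tau> d \<noteq> \<tau> e" "\<not> covers (\<tau> e) (\<tau> d)"
      by (auto simp: covers_def)
    then have "sign_change d (\<tau> d) (flip e v) = sign_change d (\<tau> d) v"
      by (rule sign_change_flip_fixed[OF v])
    moreover have "sign_change d (\<tau> d) (flip e v) * sign_change d i (flip e v)
        = sign_change d (\<tau> d) v * sign_change d i v"
      using sign_change_pair[OF v 5(2)] sign_change_pair[OF v' 5(2)] by simp
    ultimately show ?thesis using sign_change_nonzero[OF v, of d "\<tau> d"] by simp
  next
    case 6
    then have "\<tau> d = \<tau> e" by (auto simp: covers_def intro: linorder_cases[of "\<tau> d" "\<tau> e"] dest: leD)
    then show ?thesis using 6(1) inj by (auto dest: injD)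
  next
    case 7
    then show ?thesis using inj by (auto dest: injD)
  qed
qed

lemma sign_change_opposite:
  assumes "v \<in> cube_vertices"
  shows "sign_change d i (1 - v) = sign_change d i v"
  by (rule flip_invariant_constant[OF sign_change_flip opposite_vertex[OF assms] assms])

section \<open>Invariance of the great diagonals under flips\<close>

lemma flip_quadrics:
  assumes v: "v \<in> cube_vertices"
  shows "j \<noteq> d \<Longrightarrow> \<phi> (flip d v) \<in> confocal_quadric a (l j (v $ j))"
    and "\<phi> (flip d v) \<in> confocal_quadric a (l d (1 - v $ d))"
    and "has_confocal_type a (l d (1 - v $ d)) (\<tau> d)"
  using edge_quadric[OF v vertex_in_edge(2)[OF v]] vertex_bit[OF v, of d] type
    facet[OF vertex_bit vertex_in_facet, of "flip d v" d] v
  by auto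

text \<open>Opposite vertices exchange the two parameters of direction \<open>d\<close>, so their
  squares are multiplied by reciprocal factors; the signs agree by
  \<open>sign_change_opposite\<close>.\<close>

lemma flip_product:
  assumes v: "v \<in> cube_vertices"
  shows "\<phi> (flip d v) $ i * \<phi> (flip d (1 - v)) $ i = \<phi> v $ i * \<phi> (1 - v) $ i"
proof -
  have w: "1 - v \<in> cube_vertices" using v by (rule opposite_vertex)
  interpret V: orthogonal_quadrics a "\<lambda>j. l j (v $ j)" \<tau> "\<phi> v"
    by (rule vertex_quadrics[OF v])
  interpret W: orthogonal_quadrics a "\<lambda>j. l j ((1 - v) $ j)" \<tau> "\<phi> (1 - v)"
    by (rule vertex_quadrics[OF w])
  let ?x = "\<phi> v $ i" and ?y = "\<phi> (1 - v) $ i"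
    and ?x' = "\<phi> (flip d v) $ i" and ?y' = "\<phi> (flip d (1 - v)) $ i"
  have "?x'\<^sup>2 = ?x\<^sup>2 / (a i - l d (v $ d)) * (a i - l d (1 - v $ d))"
    using V.edge_end_squares[OF flip_quadrics[OF v, where d = d], of i] unfolding V.slope_def by simp
  moreover have "?y'\<^sup>2 = ?y\<^sup>2 / (a i - l d (1 - v $ d)) * (a i - l d (v $ d))"
    using W.edge_end_squares[OF flip_quadrics[OF w, where d = d], of i] unfolding W.slope_def by simp
  ultimately have "(?x' * ?y')\<^sup>2 = (?x * ?y)\<^sup>2"
    using V.neq[of i d] W.neq[of i d] by (simp add: power_mult_distrib)
  then have abs: "\<bar>?x' * ?y'\<bar> = \<bar>?x * ?y\<bar>" by (simp add: power2_eq_iff abs_eq_iff)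
  have "sgn ?x * sgn ?x' = sgn ?y * sgn ?y'"
    using sign_change_opposite[OF v, of d i] by (simp add: sign_change_def)
  moreover have "flip d (1 - v) \<in> cube_vertices" using w by simp
  ultimately have "sgn ?x' * sgn ?y' = sgn ?x * sgn ?y"
    using vertex_sgn_square[OF v, of i] vertex_sgn_square[of "flip d (1 - v)" i] by algebra
  then show ?thesis
    using abs by (metis sgn_mult mult_sgn_abs)
qed

lemma flip_norms:
  assumes v: "v \<in> cube_vertices"
  shows "(norm (\<phi> (flip d v)))\<^sup>2 + (norm (\<phi> (flip d (1 - v))))\<^sup>2 =
    (norm (\<phi> v))\<^sup>2 + (norm (\<phi> (1 - v)))\<^sup>2"
proof -
  have w: "1 - v \<in> cube_vertices" using v by (rule opposite_vertex)
  have "(norm (\<phi> (flip d v)))\<^sup>2 + l d (1 - v $ d) = (norm (\<phi> v))\<^sup>2 + l d (v $ d)"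
    by (rule orthogonal_quadrics.edge_end_norm[OF vertex_quadrics[OF v] flip_quadrics[OF v]])
  moreover have "(norm (\<phi> (flip d (1 - v))))\<^sup>2 + l d (v $ d) = (norm (\<phi> (1 - v)))\<^sup>2 + l d (1 - v $ d)"
    using orthogonal_quadrics.edge_end_norm[OF vertex_quadrics[OF w] flip_quadrics[OF w]] by simp
  ultimately show ?thesis by simp
qed

text \<open>Expanding the squared length leaves the sum of the squared norms and the inner product,
  both unchanged when the two ends are flipped in direction \<open>d\<close>.\<close>

lemma flip_great_diagonal_length:
  assumes v: "v \<in> cube_vertices"
  shows "great_diagonal_length \<phi> (flip d v) = great_diagonal_length \<phi> v"
proof -
  have "\<phi> (flip d v) \<bullet> \<phi> (flip d (1 - v)) = \<phi> v \<bullet> \<phi> (1 - v)"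
    using flip_product[OF v] by (simp add: inner_vec_def)
  then have "(norm (\<phi> (flip d v) - \<phi> (flip d (1 - v))))\<^sup>2 = (norm (\<phi> v - \<phi> (1 - v)))\<^sup>2"
    using flip_norms[OF v, of d] by (simp add: power2_norm_eq_inner inner_diff inner_commute)
  then show ?thesis
    by (simp add: great_diagonal_length_def dist_norm flip_opposite)
qed

end

theorem theorem5:
  fixes a :: "'n::{finite,linorder} \<Rightarrow> real"
    and \<phi> :: "real ^ 'n::{finite,linorder} \<Rightarrow> real ^ 'n::{finite,linorder}"
    and P :: "(real ^ 'n::{finite,linorder}) set"
  assumes "\<And>i j. i < j \<Longrightarrow> a j < a i"
    and "\<And>i. 0 < a i"
    and "confocal_parallelepiped a \<phi> P"
    and "v \<in> cube_vertices" and "w \<in> cube_vertices"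
  shows "great_diagonal_length \<phi> v = great_diagonal_length \<phi> w"
proof -
  obtain J l \<tau> where
    "continuous_on unit_cube J"
    "\<And>t. t \<in> unit_cube \<Longrightarrow> (\<phi> has_derivative (\<lambda>h. J t *v h)) (at t within unit_cube)"
    "\<And>t. t \<in> unit_cube \<Longrightarrow> invertible (J t)"
    "inj \<tau>"
    "\<And>i b. b \<in> {0, 1} \<Longrightarrow> has_confocal_type a (l i b) (\<tau> i)"
    "\<And>i b. b \<in> {0, 1} \<Longrightarrow> \<phi> ` cube_facet i b \<subseteq> confocal_quadric a (l i b)"
    using assms(3) unfolding confocal_parallelepiped_def curvilinear_parallelepiped_def by metis
  then interpret confocal_cube a \<phi> J l \<tau>
    by unfold_locales (use assms(1) in blast)+
  show ?thesis
    by (rule flip_invariant_constant[OF flip_great_diagonal_length assms(4,5)])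
qed

end
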